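(* Let $A$ be a finite skew left brace with $|A|>1$. Then $$\max\{k(A,\circ),\ \text{the number of orbits of }\psi\}\ \le\ k(\Lambda_{A^{\mathrm{op}}})\ \le\ k(A,\cdot)\,k(A,\circ),$$ where $k(G)$ denotes the number of conjugacy classes of a group $G$ and $\psi:\Lambda_{A^{\mathrm{op}}}\to\mathrm{Aut}(A,\cdot)$ is the action on $A$ given by $\psi(a,b)(x)=a\lambda^{\mathrm{op}}_b(x)a^{-1}$ for all $a,b,x\in A$.
   Context: A skew left brace is a triple $(A,\cdot,\circ)$ where $(A,\cdot)$ and $(A,\circ)$ are groups with $a\circ(b\cdot c)=(a\circ b)\cdot a^{-1}\cdot(a\circ c)$ for all $a,b,c\in A$, where $a^{-1}$ is the inverse in $(A,\cdot)$. We write $ab=a\cdot b$; the two groups share the identity $1$. The map $\lambda^{\mathrm{op}}:(A,\circ)\to\mathrm{Aut}(A,\cdot)$, $\lambda^{\mathrm{op}}_a(b)=(a\circ b)a^{-1}$, is a group homomorphism. The group $\Lambda_{A^{\mathrm{op}}}=(A,\cdot)\rtimes_{\lambda^{\mathrm{op}}}(A,\circ)$ is the set $A\times A$ with product $(a_1,b_1)(a_2,b_2)=(a_1\lambda^{\mathrm{op}}_{b_1}(a_2),\,b_1\circ b_2)$. The map $\psi$ in the claim is a group homomorphism, so it defines an action of $\Lambda_{A^{\mathrm{op}}}$ on the set $A$. *)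

theory Defs
  imports "HOL-Algebra.Group_Action"
begin

text \<open>A skew left brace \<open>(A, \<cdot>, \<circ>)\<close> is given by the two groups \<open>M = (A, \<cdot>)\<close> and \<open>C = (A, \<circ>)\<close>
  on one carrier. Maps \<open>A \<rightarrow> A\<close> are extensional, as required by \<^const>\<open>AutoGroup\<close>.\<close>

locale skew_left_brace =
  add: group M + circ: group C
  for M :: "('a, 'm) monoid_scheme" (structure) and C :: "('a, 'c) monoid_scheme" +
  assumes carrier_eq: "carrier C = carrier M"
    and brace_distrib: "\<lbrakk> a \<in> carrier M; b \<in> carrier M; c \<in> carrier M \<rbrakk> \<Longrightarrow>
      a \<otimes>\<^bsub>C\<^esub> (b \<otimes>\<^bsub>M\<^esub> c) = (a \<otimes>\<^bsub>C\<^esub> b) \<otimes>\<^bsub>M\<^esub> inv\<^bsub>M\<^esub> a \<otimes>\<^bsub>M\<^esub> (a \<otimes>\<^bsub>C\<^esub> c)"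

definition lambda_op :: "('a, 'm) monoid_scheme \<Rightarrow> ('a, 'c) monoid_scheme \<Rightarrow> 'a \<Rightarrow> 'a \<Rightarrow> 'a"
  where "lambda_op M C a = (\<lambda>b\<in>carrier M. (a \<otimes>\<^bsub>C\<^esub> b) \<otimes>\<^bsub>M\<^esub> inv\<^bsub>M\<^esub> a)"

definition semidirect_product ::
  "('a, 'm) monoid_scheme \<Rightarrow> ('b, 'c) monoid_scheme \<Rightarrow> ('b \<Rightarrow> 'a \<Rightarrow> 'a) \<Rightarrow> ('a \<times> 'b) monoid"
  where "semidirect_product N H \<phi> =
    \<lparr>carrier = carrier N \<times> carrier H,
     mult = (\<lambda>(a1, b1) (a2, b2). (a1 \<otimes>\<^bsub>N\<^esub> \<phi> b1 a2, b1 \<otimes>\<^bsub>H\<^esub> b2)),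
     one = (\<one>\<^bsub>N\<^esub>, \<one>\<^bsub>H\<^esub>)\<rparr>"

definition Lambda_op :: "('a, 'm) monoid_scheme \<Rightarrow> ('a, 'c) monoid_scheme \<Rightarrow> ('a \<times> 'a) monoid"
  where "Lambda_op M C = semidirect_product M C (lambda_op M C)"

definition brace_psi ::
  "('a, 'm) monoid_scheme \<Rightarrow> ('a, 'c) monoid_scheme \<Rightarrow> 'a \<times> 'a \<Rightarrow> 'a \<Rightarrow> 'a"
  where "brace_psi M C = (\<lambda>(a, b). \<lambda>x\<in>carrier M. a \<otimes>\<^bsub>M\<^esub> lambda_op M C b x \<otimes>\<^bsub>M\<^esub> inv\<^bsub>M\<^esub> a)"

definition conjugacy_classes :: "('a, 'm) monoid_scheme \<Rightarrow> 'a set set"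
  where "conjugacy_classes G =
    orbits G (carrier G) (\<lambda>g. \<lambda>h\<in>carrier G. g \<otimes>\<^bsub>G\<^esub> h \<otimes>\<^bsub>G\<^esub> inv\<^bsub>G\<^esub> g)"

definition class_number :: "('a, 'm) monoid_scheme \<Rightarrow> nat"
  where "class_number G = card (conjugacy_classes G)"

text \<open>The facts making the above well defined: the identities of the two groups agree,
  the action is by automorphisms, \<open>Lambda_op M C\<close> is a group, and \<open>brace_psi M C\<close> is a
  homomorphism into the automorphism group.\<close>

lemma group_semidirect_product:
  assumes N: "group N" and H: "group H" and hom: "\<phi> \<in> hom H (AutoGroup N)"
  shows "group (semidirect_product N H \<phi>)"
proof -
  interpret N: group N by fact
  interpret H: group H by fact
  have aut: "\<phi> b \<in> hom N N" "\<phi> b \<in> Bij (carrier N)" if "b \<in> carrier H" for b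
    using hom that by (auto simp: hom_def[of H] AutoGroup_def auto_def)
  have cl: "\<phi> b x \<in> carrier N" if "b \<in> carrier H" "x \<in> carrier N" for b x
    using aut(1)[OF that(1)] that by (auto simp: hom_def)
  have mul: "\<phi> b (x \<otimes>\<^bsub>N\<^esub> y) = \<phi> b x \<otimes>\<^bsub>N\<^esub> \<phi> b y"
    if "b \<in> carrier H" "x \<in> carrier N" "y \<in> carrier N" for b x y
    using aut(1)[OF that(1)] that by (auto simp: hom_def)
  have act: "\<phi> (b \<otimes>\<^bsub>H\<^esub> c) x = \<phi> b (\<phi> c x)"
    if "b \<in> carrier H" "c \<in> carrier H" "x \<in> carrier N" for b c x
    using hom that aut(2) by (auto simp: hom_def AutoGroup_def BijGroup_def compose_def)
  have one: "\<phi> \<one>\<^bsub>H\<^esub> x = x" if "x \<in> carrier N" for x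
  proof -
    have "inj_on (\<phi> \<one>\<^bsub>H\<^esub>) (carrier N)"
      using aut(2)[of "\<one>\<^bsub>H\<^esub>"] by (auto simp: Bij_def bij_betw_def)
    moreover have "\<phi> \<one>\<^bsub>H\<^esub> (\<phi> \<one>\<^bsub>H\<^esub> x) = \<phi> \<one>\<^bsub>H\<^esub> x"
      using act[of "\<one>\<^bsub>H\<^esub>" "\<one>\<^bsub>H\<^esub>" x] that by simp
    ultimately show ?thesis using that cl by (auto dest: inj_onD)
  qed
  show ?thesis
  proof (rule groupI, goal_cases)
    case (5 z)
    then obtain a b where z: "z = (a, b)" "a \<in> carrier N" "b \<in> carrier H"
      by (auto simp: semidirect_product_def)
    let ?b = "inv\<^bsub>H\<^esub> b"
    have "\<phi> ?b (inv\<^bsub>N\<^esub> a) \<otimes>\<^bsub>N\<^esub> \<phi> ?b a = \<one>\<^bsub>N\<^esub>"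
    proof -
      have "\<phi> ?b \<one>\<^bsub>N\<^esub> = \<one>\<^bsub>N\<^esub>"
        using mul[of ?b "\<one>\<^bsub>N\<^esub>" "\<one>\<^bsub>N\<^esub>"] cl[of ?b "\<one>\<^bsub>N\<^esub>"] z N.l_cancel_one by fastforce
      then show ?thesis using mul[of ?b "inv\<^bsub>N\<^esub> a" a] z by simp
    qed
    then show ?case using z cl
      by (intro bexI[of _ "(\<phi> ?b (inv\<^bsub>N\<^esub> a), ?b)"]) (auto simp: semidirect_product_def)
  qed (auto simp: semidirect_product_def cl mul act one N.m_assoc H.m_assoc)
qed

context skew_left_brace
begin

lemma C_closed [simp]: "\<lbrakk> a \<in> carrier M; b \<in> carrier M \<rbrakk> \<Longrightarrow> a \<otimes>\<^bsub>C\<^esub> b \<in> carrier M"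
  using circ.m_closed carrier_eq by simp

lemma one_eq: "\<one>\<^bsub>C\<^esub> = \<one>\<^bsub>M\<^esub>"
proof -
  let ?e = "\<one>\<^bsub>C\<^esub>"
  have e: "?e \<in> carrier M" using circ.one_closed carrier_eq by simp
  have l: "?e \<otimes>\<^bsub>C\<^esub> x = x" if "x \<in> carrier M" for x using that carrier_eq by simp
  have "\<one>\<^bsub>M\<^esub> = inv\<^bsub>M\<^esub> ?e"
    using brace_distrib[OF e add.one_closed add.one_closed] e by (simp add: l)
  then show ?thesis using e by (metis add.inv_inv add.inv_one)
qed

lemma circ_one [simp]: "a \<in> carrier M \<Longrightarrow> a \<otimes>\<^bsub>C\<^esub> \<one>\<^bsub>M\<^esub> = a"
  using circ.r_one carrier_eq one_eq by metis

lemma cancel [simp]: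
  assumes "x \<in> carrier M" "y \<in> carrier M"
  shows "inv\<^bsub>M\<^esub> x \<otimes>\<^bsub>M\<^esub> (x \<otimes>\<^bsub>M\<^esub> y) = y" "x \<otimes>\<^bsub>M\<^esub> (inv\<^bsub>M\<^esub> x \<otimes>\<^bsub>M\<^esub> y) = y"
  using assms by (simp_all flip: add.m_assoc)

lemma circ_inv:
  assumes a: "a \<in> carrier M" and b: "b \<in> carrier M"
  shows "a \<otimes>\<^bsub>C\<^esub> inv\<^bsub>M\<^esub> b = a \<otimes>\<^bsub>M\<^esub> inv\<^bsub>M\<^esub> (a \<otimes>\<^bsub>C\<^esub> b) \<otimes>\<^bsub>M\<^esub> a"
proof -
  have "a = (a \<otimes>\<^bsub>C\<^esub> b) \<otimes>\<^bsub>M\<^esub> inv\<^bsub>M\<^esub> a \<otimes>\<^bsub>M\<^esub> (a \<otimes>\<^bsub>C\<^esub> inv\<^bsub>M\<^esub> b)"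
    using brace_distrib[OF a b add.inv_closed[OF b]] a b by simp
  then have "a \<otimes>\<^bsub>M\<^esub> inv\<^bsub>M\<^esub> (a \<otimes>\<^bsub>C\<^esub> b) \<otimes>\<^bsub>M\<^esub> a =
    a \<otimes>\<^bsub>M\<^esub> inv\<^bsub>M\<^esub> (a \<otimes>\<^bsub>C\<^esub> b) \<otimes>\<^bsub>M\<^esub> ((a \<otimes>\<^bsub>C\<^esub> b) \<otimes>\<^bsub>M\<^esub> inv\<^bsub>M\<^esub> a \<otimes>\<^bsub>M\<^esub> (a \<otimes>\<^bsub>C\<^esub> inv\<^bsub>M\<^esub> b))"
    by simp
  also have "\<dots> = a \<otimes>\<^bsub>C\<^esub> inv\<^bsub>M\<^esub> b"
    using a b by (simp add: add.m_assoc)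
  finally show ?thesis by simp
qed

lemma lambda_op_closed [simp]:
  "\<lbrakk> a \<in> carrier M; b \<in> carrier M \<rbrakk> \<Longrightarrow> lambda_op M C a b \<in> carrier M"
  by (simp add: lambda_op_def)

lemma lambda_op_mult:
  "\<lbrakk> a \<in> carrier M; b \<in> carrier M; c \<in> carrier M \<rbrakk> \<Longrightarrow>
    lambda_op M C a (b \<otimes>\<^bsub>M\<^esub> c) = lambda_op M C a b \<otimes>\<^bsub>M\<^esub> lambda_op M C a c"
  by (simp add: lambda_op_def brace_distrib add.m_assoc)

lemma lambda_op_circ:
  assumes "a \<in> carrier M" "b \<in> carrier M" "x \<in> carrier M"
  shows "lambda_op M C (a \<otimes>\<^bsub>C\<^esub> b) x = lambda_op M C a (lambda_op M C b x)"
proof -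
  have "a \<otimes>\<^bsub>C\<^esub> b \<otimes>\<^bsub>C\<^esub> x = a \<otimes>\<^bsub>C\<^esub> (b \<otimes>\<^bsub>C\<^esub> x)"
    using assms carrier_eq circ.m_assoc by simp
  then show ?thesis using assms
    by (simp add: lambda_op_def brace_distrib circ_inv add.m_assoc)
qed

lemma lambda_op_auto:
  assumes a: "a \<in> carrier M"
  shows "lambda_op M C a \<in> auto M"
proof -
  have "inj_on (lambda_op M C a) (carrier M)"
    using a carrier_eq by (auto intro!: inj_onI simp: lambda_op_def)
  moreover have "y \<in> lambda_op M C a ` carrier M" if y: "y \<in> carrier M" for y
  proof (rule image_eqI)
    let ?x = "inv\<^bsub>C\<^esub> a \<otimes>\<^bsub>C\<^esub> (y \<otimes>\<^bsub>M\<^esub> a)"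
    have i: "inv\<^bsub>C\<^esub> a \<in> carrier M" using a carrier_eq circ.inv_closed by simp
    show "?x \<in> carrier M" using i a y by simp
    have "a \<otimes>\<^bsub>C\<^esub> ?x = y \<otimes>\<^bsub>M\<^esub> a"
      using a y i carrier_eq circ.m_assoc[of a "inv\<^bsub>C\<^esub> a" "y \<otimes>\<^bsub>M\<^esub> a"] by simp
    then show "y = lambda_op M C a ?x"
      using i a y by (simp add: lambda_op_def add.m_assoc)
  qed
  ultimately have "bij_betw (lambda_op M C a) (carrier M) (carrier M)"
    using a by (auto simp: bij_betw_def)
  then show ?thesis
    using a by (auto simp: auto_def hom_def Bij_def lambda_op_mult) (simp add: lambda_op_def)
qed

lemma lambda_op_hom: "lambda_op M C \<in> hom C (AutoGroup M)"
proof (rule homI)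
  show "lambda_op M C a \<in> carrier (AutoGroup M)" if "a \<in> carrier C" for a
    using that lambda_op_auto carrier_eq by (simp add: AutoGroup_def)
next
  fix a b assume ab: "a \<in> carrier C" "b \<in> carrier C"
  have "lambda_op M C (a \<otimes>\<^bsub>C\<^esub> b) = compose (carrier M) (lambda_op M C a) (lambda_op M C b)"
    using ab carrier_eq lambda_op_circ
    by (intro extensionalityI[of _ "carrier M"]) (auto simp: compose_def, simp add: lambda_op_def)
  then show "lambda_op M C (a \<otimes>\<^bsub>C\<^esub> b) = lambda_op M C a \<otimes>\<^bsub>AutoGroup M\<^esub> lambda_op M C b"
    using ab carrier_eq lambda_op_auto by (simp add: AutoGroup_def BijGroup_def auto_def)
qed

lemma group_Lambda_op: "group (Lambda_op M C)"
  unfolding Lambda_op_def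
  by (rule group_semidirect_product[OF add.is_group circ.is_group lambda_op_hom])

lemma brace_psi_eq:
  "\<lbrakk> a \<in> carrier M; b \<in> carrier M \<rbrakk> \<Longrightarrow> brace_psi M C (a, b) =
    compose (carrier M) (\<lambda>x\<in>carrier M. a \<otimes>\<^bsub>M\<^esub> x \<otimes>\<^bsub>M\<^esub> inv\<^bsub>M\<^esub> a) (lambda_op M C b)"
  by (auto simp: brace_psi_def compose_def fun_eq_iff)

lemma brace_psi_auto:
  assumes "a \<in> carrier M" "b \<in> carrier M"
  shows "brace_psi M C (a, b) \<in> auto M"
proof -
  let ?c = "\<lambda>x\<in>carrier M. a \<otimes>\<^bsub>M\<^esub> x \<otimes>\<^bsub>M\<^esub> inv\<^bsub>M\<^esub> a"
  have c: "?c \<in> auto M"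
    using assms add.conjugation_is_bij[of a]
    by (auto simp: auto_def Bij_def hom_def add.m_assoc)
  show ?thesis
    unfolding brace_psi_eq[OF assms]
    using c lambda_op_auto[OF assms(2)] add.hom_compose compose_Bij
    by (auto simp: auto_def Bij_imp_funcset)
qed

lemma brace_psi_hom: "brace_psi M C \<in> hom (Lambda_op M C) (AutoGroup M)"
proof (rule homI)
  show "brace_psi M C z \<in> carrier (AutoGroup M)" if "z \<in> carrier (Lambda_op M C)" for z
    using that brace_psi_auto carrier_eq
    by (auto simp: Lambda_op_def semidirect_product_def AutoGroup_def)
next
  fix y z assume "y \<in> carrier (Lambda_op M C)" "z \<in> carrier (Lambda_op M C)"
  then obtain a b c d where yz: "y = (a, b)" "z = (c, d)"
    and m: "a \<in> carrier M" "b \<in> carrier M" "c \<in> carrier M" "d \<in> carrier M"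
    using carrier_eq by (auto simp: Lambda_op_def semidirect_product_def)
  have i: "lambda_op M C b (inv\<^bsub>M\<^esub> c) = inv\<^bsub>M\<^esub> (lambda_op M C b c)"
  proof -
    have "lambda_op M C b \<one>\<^bsub>M\<^esub> = \<one>\<^bsub>M\<^esub>" using m by (simp add: lambda_op_def)
    then show ?thesis
      using m lambda_op_mult[of b "inv\<^bsub>M\<^esub> c" c] by (simp add: add.inv_equality)
  qed
  have "brace_psi M C (a \<otimes>\<^bsub>M\<^esub> lambda_op M C b c, b \<otimes>\<^bsub>C\<^esub> d) =
      compose (carrier M) (brace_psi M C (a, b)) (brace_psi M C (c, d))"
    using m by (auto simp: brace_psi_def compose_def fun_eq_iff lambda_op_circ lambda_op_mult
        i add.inv_mult_group add.m_assoc)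
  then show "brace_psi M C (y \<otimes>\<^bsub>Lambda_op M C\<^esub> z) =
      brace_psi M C y \<otimes>\<^bsub>AutoGroup M\<^esub> brace_psi M C z"
    using m brace_psi_auto
    by (simp add: yz Lambda_op_def semidirect_product_def AutoGroup_def BijGroup_def auto_def)
qed

end

end

theory Submission
  imports Defs
begin

text \<open>The lower bounds: the projection to \<open>(A, \<circ>)\<close> is a surjective homomorphism, so it maps
  conjugacy classes onto conjugacy classes, and the conjugacy classes of \<open>\<Lambda>\<close> inside the
  normal subgroup \<open>A \<times> {1}\<close> are the orbits of \<open>\<psi>\<close>. For the upper bound, \<open>k(G) |G|\<close> is the
  number of commuting pairs of \<open>G\<close>. If \<open>N\<close> is the kernel of \<open>G \<rightarrow> Q\<close>, every fibre of
  the induced map from commuting pairs of \<open>G\<close> to commuting pairs of \<open>Q\<close> is at most as large as the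
  set of commuting pairs of \<open>N\<close>, because the centralizer of an element meets each coset of
  \<open>N\<close> in at most as many elements as it meets \<open>N\<close> itself.\<close>

text \<open>Only the carrier and the product enter, so the set also makes sense for \<open>G\<close>
  with its carrier cut down to a kernel, with no subgroup argument.\<close>

definition commuting_pairs :: "('a, 'm) monoid_scheme \<Rightarrow> ('a \<times> 'a) set"
  where "commuting_pairs G =
    {(x, y). x \<in> carrier G \<and> y \<in> carrier G \<and> x \<otimes>\<^bsub>G\<^esub> y = y \<otimes>\<^bsub>G\<^esub> x}"

text \<open>Burnside's lemma for the conjugation action: the fixed points of \<open>g\<close> form
  its centralizer, so summing over \<open>g\<close> counts commuting pairs.\<close>

lemma (in group) class_number_mult_order:
  assumes "finite (carrier G)"
  shows "class_number G * order G = card (commuting_pairs G)"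
proof -
  let ?\<phi> = "\<lambda>g. \<lambda>h\<in>carrier G. g \<otimes> h \<otimes> inv g"
  interpret conj: group_action G "carrier G" ?\<phi>
    by (rule action_by_conjugation)
  have "commuting_pairs G = (SIGMA g:carrier G. invariants (carrier G) ?\<phi> g)"
    by (auto simp: commuting_pairs_def invariants_def inv_solve_right')
  then show ?thesis
    using conj.burnside assms
    by (simp add: class_number_def conjugacy_classes_def invariants_def)
qed

lemma (in group) conjugacy_classes_eq:
  "conjugacy_classes G = (\<lambda>x. (\<lambda>g. g \<otimes> x \<otimes> inv g) ` carrier G) ` carrier G"
  by (auto simp: conjugacy_classes_def orbits_def orbit_def image_def)

context group_hom
begin

text \<open>By surjectivity, conjugating \<open>h x\<close> by all of \<open>H\<close> gives exactly
  the image of the class of \<open>x\<close>.\<close>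

lemma class_number_le_of_surj:
  assumes surj: "h ` carrier G = carrier H" and "finite (carrier G)"
  shows "class_number H \<le> class_number G"
proof -
  have "h ` (\<lambda>g. g \<otimes> x \<otimes> inv g) ` carrier G =
      (\<lambda>g. g \<otimes>\<^bsub>H\<^esub> h x \<otimes>\<^bsub>H\<^esub> inv\<^bsub>H\<^esub> g) ` carrier H" if "x \<in> carrier G" for x
    using that by (simp add: image_image flip: surj cong: image_cong_simp)
  then have "conjugacy_classes H = (`) h ` conjugacy_classes G"
    unfolding H.conjugacy_classes_eq G.conjugacy_classes_eq
    by (simp add: image_image flip: surj cong: image_cong_simp)
  then show ?thesis
    using assms(2) by (simp add: class_number_def G.conjugacy_classes_eq card_image_le)
qed

text \<open>A nonempty fibre is translated into the kernel by the inverse of one of its members,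
  which stays inside the centralizer of \<open>x\<close>. Since \<open>x\<close> may lie outside the
  kernel, the bound serves both coordinates of a commuting pair.\<close>

lemma card_centralizer_fibre_le:
  assumes "finite (carrier G)" and x: "x \<in> carrier G"
  shows "card {y \<in> carrier G. h y = v \<and> x \<otimes> y = y \<otimes> x}
    \<le> card {n \<in> kernel G H h. x \<otimes> n = n \<otimes> x}" (is "card ?F \<le> card ?K")
proof (cases "?F = {}")
  case False
  then obtain z where z: "z \<in> carrier G" "h z = v" "x \<otimes> z = z \<otimes> x" by auto
  show ?thesis
  proof (rule card_inj_on_le)
    show "inj_on (\<lambda>y. y \<otimes> inv z) ?F" using z by (auto intro!: inj_onI)
    have "x \<otimes> (y \<otimes> inv z) = y \<otimes> inv z \<otimes> x" if "y \<in> carrier G" "x \<otimes> y = y \<otimes> x" for y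
    proof -
      have "x \<otimes> inv z = inv z \<otimes> x"
        using x z G.inv_comm[of z] by (metis G.inv_closed G.inv_solve_left G.inv_solve_right G.m_assoc G.m_closed)
      then show ?thesis using that x z by (metis G.inv_closed G.m_assoc)
    qed
    then show "(\<lambda>y. y \<otimes> inv z) ` ?F \<subseteq> ?K" using z by (auto simp: kernel_def)
    show "finite ?K" using assms(1) by (simp add: kernel_def)
  qed
qed (simp only: card.empty)

lemma card_commuting_pairs_le:
  assumes fin: "finite (carrier G)" and finH: "finite (carrier H)"
  shows "card (commuting_pairs G)
    \<le> card (commuting_pairs (G\<lparr>carrier := kernel G H h\<rparr>)) * card (commuting_pairs H)"
proof -
  let ?N = "kernel G H h"
  let ?p = "\<lambda>(x, y). (h x, h y)"
  have finN: "finite ?N" using fin by (simp add: kernel_def)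
  have fibre: "card {z \<in> commuting_pairs G. ?p z = w}
      \<le> card (commuting_pairs (G\<lparr>carrier := ?N\<rparr>))" for w
  proof -
    obtain u v where w: "w = (u, v)" by fastforce
    let ?U = "{x \<in> carrier G. h x = u}"
    have finU: "finite ?U" using fin by simp
    have "{z \<in> commuting_pairs G. ?p z = w} =
        (SIGMA x:?U. {y \<in> carrier G. h y = v \<and> x \<otimes> y = y \<otimes> x})"
      by (auto simp: commuting_pairs_def w)
    then have "card {z \<in> commuting_pairs G. ?p z = w} =
        (\<Sum>x\<in>?U. card {y \<in> carrier G. h y = v \<and> x \<otimes> y = y \<otimes> x})"
      using fin by simp
    also have "\<dots> \<le> (\<Sum>x\<in>?U. card {n \<in> ?N. x \<otimes> n = n \<otimes> x})"
      by (rule sum_mono) (simp add: card_centralizer_fibre_le fin)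
    \<comment> \<open>Double counting: the second coordinate now lies in the kernel, and exchanging
      the sums fixes it so that the first can be moved there too.\<close>
    also have "\<dots> = (\<Sum>n\<in>?N. card {x \<in> ?U. x \<otimes> n = n \<otimes> x})"
      using sum_multicount_gen[OF finU finN, of "\<lambda>x n. x \<otimes> n = n \<otimes> x"
          "\<lambda>n. card {x \<in> ?U. x \<otimes> n = n \<otimes> x}"] by simp
    also have "\<dots> \<le> (\<Sum>n\<in>?N. card {m \<in> ?N. n \<otimes> m = m \<otimes> n})"
    proof (rule sum_mono)
      fix n assume "n \<in> ?N"
      then have "n \<in> carrier G" by (simp add: kernel_def)
      moreover have "{x \<in> ?U. x \<otimes> n = n \<otimes> x} = {x \<in> carrier G. h x = u \<and> n \<otimes> x = x \<otimes> n}"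
        by auto
      ultimately show "card {x \<in> ?U. x \<otimes> n = n \<otimes> x} \<le> card {m \<in> ?N. n \<otimes> m = m \<otimes> n}"
        using card_centralizer_fibre_le[OF fin, of n u] by simp
    qed
    also have "\<dots> = card (SIGMA n:?N. {m \<in> ?N. n \<otimes> m = m \<otimes> n})"
      using finN by simp
    also have "(SIGMA n:?N. {m \<in> ?N. n \<otimes> m = m \<otimes> n}) = commuting_pairs (G\<lparr>carrier := ?N\<rparr>)"
      by (auto simp: commuting_pairs_def)
    finally show ?thesis .
  qed
  have "commuting_pairs H \<subseteq> carrier H \<times> carrier H"
    by (auto simp: commuting_pairs_def)
  then have finP: "finite (commuting_pairs H)"
    using finH finite_subset by blast
  have "?p ` commuting_pairs G \<subseteq> commuting_pairs H"
    by (auto simp: commuting_pairs_def simp flip: hom_mult)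
  \<comment> \<open>The fibres of \<open>?p\<close> over commuting pairs of \<open>H\<close> exhaust
    \<open>commuting_pairs G\<close>, and each obeys the same bound.\<close>
  then have "commuting_pairs G = (\<Union>w\<in>commuting_pairs H. {z \<in> commuting_pairs G. ?p z = w})"
    by blast
  then have "card (commuting_pairs G)
      \<le> (\<Sum>w\<in>commuting_pairs H. card {z \<in> commuting_pairs G. ?p z = w})"
    using card_UN_le[OF finP, of "\<lambda>w. {z \<in> commuting_pairs G. ?p z = w}"] by simp
  also have "\<dots> \<le> (\<Sum>w\<in>commuting_pairs H. card (commuting_pairs (G\<lparr>carrier := ?N\<rparr>)))"
    by (intro sum_mono fibre)
  finally show ?thesis by (simp add: mult.commute)
qed

end

context skew_left_brace
begin

lemma Lambda_op_simps [simp]: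
  "carrier (Lambda_op M C) = carrier M \<times> carrier M"
  "(a, b) \<otimes>\<^bsub>Lambda_op M C\<^esub> (c, d) = (a \<otimes>\<^bsub>M\<^esub> lambda_op M C b c, b \<otimes>\<^bsub>C\<^esub> d)"
  by (simp_all add: Lambda_op_def semidirect_product_def carrier_eq)

lemma lambda_op_one [simp]:
  assumes "x \<in> carrier M"
  shows "lambda_op M C \<one>\<^bsub>M\<^esub> x = x" "lambda_op M C x \<one>\<^bsub>M\<^esub> = \<one>\<^bsub>M\<^esub>"
  using assms circ.l_one[of x] by (simp_all add: lambda_op_def carrier_eq one_eq)

lemma group_hom_snd: "group_hom (Lambda_op M C) C snd"
  using group_Lambda_op circ.is_group carrier_eq
  by (auto intro!: group_hom.intro simp: group_hom_axioms_def hom_def)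

lemma Lambda_op_conj:
  assumes "a \<in> carrier M" "b \<in> carrier M" "x \<in> carrier M"
  shows "(a, b) \<otimes>\<^bsub>Lambda_op M C\<^esub> (x, \<one>\<^bsub>M\<^esub>) \<otimes>\<^bsub>Lambda_op M C\<^esub> inv\<^bsub>Lambda_op M C\<^esub> (a, b)
    = (brace_psi M C (a, b) x, \<one>\<^bsub>M\<^esub>)"
proof -
  interpret L: group "Lambda_op M C" by (rule group_Lambda_op)
  have "\<one>\<^bsub>M\<^esub> \<otimes>\<^bsub>C\<^esub> b = b" using assms carrier_eq by (simp flip: one_eq)
  \<comment> \<open>Moving the inverse to the other side avoids computing inverses in the semidirect
    product.\<close>
  then have "(a, b) \<otimes>\<^bsub>Lambda_op M C\<^esub> (x, \<one>\<^bsub>M\<^esub>) =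
      (brace_psi M C (a, b) x, \<one>\<^bsub>M\<^esub>) \<otimes>\<^bsub>Lambda_op M C\<^esub> (a, b)"
    using assms by (simp add: brace_psi_def add.m_assoc)
  then show ?thesis
    using assms by (intro L.inv_solve_right'[THEN iffD2]) (simp_all add: brace_psi_def)
qed

lemma card_orbits_brace_psi_le:
  assumes fin: "finite (carrier M)"
  shows "card (orbits (Lambda_op M C) (carrier M) (brace_psi M C)) \<le> class_number (Lambda_op M C)"
proof -
  interpret L: group "Lambda_op M C" by (rule group_Lambda_op)
  let ?i = "\<lambda>x. (x, \<one>\<^bsub>M\<^esub>)"
  have "?i ` orbit (Lambda_op M C) (brace_psi M C) x \<in> conjugacy_classes (Lambda_op M C)"
    if x: "x \<in> carrier M" for x
  proof -
    have "?i ` orbit (Lambda_op M C) (brace_psi M C) x =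
        (\<lambda>g. g \<otimes>\<^bsub>Lambda_op M C\<^esub> ?i x \<otimes>\<^bsub>Lambda_op M C\<^esub> inv\<^bsub>Lambda_op M C\<^esub> g) `
          carrier (Lambda_op M C)"
      \<comment> \<open>The product rule is switched off so that \<open>Lambda_op_conj\<close> still
        matches.\<close>
      using x by (force simp: orbit_def Lambda_op_conj simp del: Lambda_op_simps(2))
    then show ?thesis using x by (simp add: L.conjugacy_classes_eq)
  qed
  then have "(`) ?i ` orbits (Lambda_op M C) (carrier M) (brace_psi M C)
      \<subseteq> conjugacy_classes (Lambda_op M C)"
    by (auto simp: orbits_def)
  moreover have "inj_on ((`) ?i) X" for X
    by (auto intro!: inj_onI simp: inj_image_eq_iff inj_def)
  ultimately show ?thesis
    unfolding class_number_def
    using fin by (intro card_inj_on_le) (auto simp: L.conjugacy_classes_eq)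
qed

text \<open>The kernel is a copy of \<open>M\<close>: its second entries are the identity, which
  acts trivially through \<open>lambda_op\<close>.\<close>

lemma card_commuting_pairs_kernel_snd:
  "card (commuting_pairs (Lambda_op M C\<lparr>carrier := kernel (Lambda_op M C) C snd\<rparr>))
    = card (commuting_pairs M)"
proof -
  let ?f = "\<lambda>(x, y). ((x, \<one>\<^bsub>M\<^esub>), (y, \<one>\<^bsub>M\<^esub>))"
  have "commuting_pairs (Lambda_op M C\<lparr>carrier := kernel (Lambda_op M C) C snd\<rparr>)
      = ?f ` commuting_pairs M"
    by (auto simp: commuting_pairs_def kernel_def one_eq image_iff)
  moreover have "inj_on ?f (commuting_pairs M)" by (auto intro!: inj_onI)
  ultimately show ?thesis by (simp add: card_image)
qed

lemma class_number_Lambda_op_le: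
  assumes fin: "finite (carrier M)"
  shows "class_number (Lambda_op M C) \<le> class_number M * class_number C"
proof -
  interpret L: group "Lambda_op M C" by (rule group_Lambda_op)
  interpret p: group_hom "Lambda_op M C" C snd by (rule group_hom_snd)
  \<comment> \<open>Both sides are scaled by the order of \<open>Lambda_op M C\<close>, the square
    of \<open>order M\<close>, which is positive and cancels at the end.\<close>
  have "class_number (Lambda_op M C) * (order M * order M) = card (commuting_pairs (Lambda_op M C))"
    using L.class_number_mult_order fin by (simp add: order_def card_cartesian_product)
  also have "\<dots> \<le> card (commuting_pairs M) * card (commuting_pairs C)"
    using p.card_commuting_pairs_le fin by (simp add: carrier_eq card_commuting_pairs_kernel_snd)
  also have "\<dots> = class_number M * class_number C * (order M * order M)"
    using add.class_number_mult_order circ.class_number_mult_order fin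
    by (simp add: order_def carrier_eq flip: ac_simps)
  finally show ?thesis using add.order_gt_0_iff_finite fin by simp
qed

end

theorem theorem5p2:
  fixes M :: "('a, 'm) monoid_scheme" and C :: "('a, 'c) monoid_scheme"
  assumes "skew_left_brace M C"
    and "finite (carrier M)"
    and "card (carrier M) > 1"
  shows "max (class_number C) (card (orbits (Lambda_op M C) (carrier M) (brace_psi M C)))
           \<le> class_number (Lambda_op M C)
       \<and> class_number (Lambda_op M C) \<le> class_number M * class_number C"
proof -
  interpret skew_left_brace M C by fact
  interpret p: group_hom "Lambda_op M C" C snd by (rule group_hom_snd)
  have "snd ` carrier (Lambda_op M C) = carrier C"
    using carrier_eq by auto
  then have "class_number C \<le> class_number (Lambda_op M C)"
    using p.class_number_le_of_surj assms(2) by simp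
  then show ?thesis
    using card_orbits_brace_psi_le class_number_Lambda_op_le assms(2) by simp
qed

end
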